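(* Let $1<p<\infty$. Then the Kalton--Peck map $\mathscr K(f)=f\log\frac{|f|}{\|f\|}$ on $L_p=L_p(0,1)$ is disjointly singular; that is, there are no sequence $(u_n)_{n\ge1}$ of nonzero pairwise disjointly supported functions in $L_p$ with closed linear span $W=[u_n]$, linear map $\ell:W\to L_0$ and constant $C$ such that $\mathscr K(f)-\ell(f)\in L_p$ and $\|\mathscr K(f)-\ell(f)\|_p\le C\|f\|_p$ for all $f\in W$.
   Context: Scalars are complex. $L_0$ is the space of (classes of) measurable functions on $(0,1)$. In the formula for $\mathscr K$, $\|f\|$ is the $L_p$-norm, $\mathscr K(0)=0$, and $f\log(|f|/\|f\|)$ is taken to be $0$ at points where $f=0$; $\mathscr K$ takes values in $L_0$. *)

theory Defs
  imports "HOL-Analysis.Analysis"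
begin

text \<open>
  Elements of \<open>L\<^sub>0\<close> and \<open>L\<^sub>p\<close> are classes of functions modulo equality almost everywhere. They are
  handled here through representatives: equations between elements become equations almost
  everywhere, and maps defined on classes are maps on representatives that respect
  equality almost everywhere.
\<close>

abbreviation I01 :: "real measure" where
  "I01 \<equiv> lebesgue_on {0<..<1}"

definition L0 :: "(real \<Rightarrow> complex) set" where
  "L0 = borel_measurable I01"

definition Lp :: "real \<Rightarrow> (real \<Rightarrow> complex) set" where
  "Lp p = {f \<in> L0. integrable I01 (\<lambda>x. norm (f x) powr p)}"

definition Lp_norm :: "real \<Rightarrow> (real \<Rightarrow> complex) \<Rightarrow> real" where
  "Lp_norm p f = (LINT x|I01. norm (f x) powr p) powr (1 / p)"

definition kalton_peck :: "real \<Rightarrow> (real \<Rightarrow> complex) \<Rightarrow> real \<Rightarrow> complex" where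
  "kalton_peck p f =
     (if Lp_norm p f = 0 then (\<lambda>x. 0)
      else (\<lambda>x. if f x = 0 then 0 else f x * complex_of_real (ln (norm (f x) / Lp_norm p f))))"

definition lin_span :: "(nat \<Rightarrow> real \<Rightarrow> complex) \<Rightarrow> (real \<Rightarrow> complex) set" where
  "lin_span u = {(\<lambda>x. \<Sum>k<n. c k * u k x) | n c. True}"

definition closed_span :: "real \<Rightarrow> (nat \<Rightarrow> real \<Rightarrow> complex) \<Rightarrow> (real \<Rightarrow> complex) set" where
  "closed_span p u =
     {f \<in> Lp p. \<forall>\<epsilon>>0. \<exists>g\<in>lin_span u. Lp_norm p (\<lambda>x. f x - g x) < \<epsilon>}"

definition linear_into_L0 ::
  "(real \<Rightarrow> complex) set \<Rightarrow> ((real \<Rightarrow> complex) \<Rightarrow> (real \<Rightarrow> complex)) \<Rightarrow> bool" where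
  "linear_into_L0 W l \<longleftrightarrow>
     (\<forall>f\<in>W. l f \<in> L0) \<and>
     (\<forall>f\<in>W. \<forall>g\<in>W. (AE x in I01. f x = g x) \<longrightarrow> (AE x in I01. l f x = l g x)) \<and>
     (\<forall>f\<in>W. \<forall>g\<in>W. AE x in I01. l (\<lambda>t. f t + g t) x = l f x + l g x) \<and>
     (\<forall>c. \<forall>f\<in>W. AE x in I01. l (\<lambda>t. c * f t) x = c * l f x)"

definition nonzero_disjoint_seq :: "real \<Rightarrow> (nat \<Rightarrow> real \<Rightarrow> complex) \<Rightarrow> bool" where
  "nonzero_disjoint_seq p u \<longleftrightarrow>
     (\<forall>n. u n \<in> Lp p) \<and>
     (\<forall>n. \<not> (AE x in I01. u n x = 0)) \<and>
     (\<forall>m n. m \<noteq> n \<longrightarrow> (AE x in I01. u m x = 0 \<or> u n x = 0))"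

definition disjointly_singular ::
  "real \<Rightarrow> ((real \<Rightarrow> complex) \<Rightarrow> (real \<Rightarrow> complex)) \<Rightarrow> bool" where
  "disjointly_singular p \<Omega> \<longleftrightarrow>
     \<not> (\<exists>u l C. nonzero_disjoint_seq p u \<and> linear_into_L0 (closed_span p u) l \<and>
          (\<forall>f\<in>closed_span p u.
             (\<lambda>x. \<Omega> f x - l f x) \<in> Lp p \<and>
             Lp_norm p (\<lambda>x. \<Omega> f x - l f x) \<le> C * Lp_norm p f))"

end

theory Submission
  imports Defs
begin

text \<open>
  Suppose a linear \<open>l\<close> stays within distance \<open>C\<close> of \<open>\<K>\<close>, and let \<open>b\<^sub>k\<close> be the normalised \<open>u\<^sub>k\<close>
  and \<open>w\<^sub>k = \<K>(b\<^sub>k) - l(b\<^sub>k)\<close>, so that the norm of \<open>w\<^sub>k\<close> is at most \<open>C\<close>. For signs \<open>\<epsilon>\<^sub>k\<close> the vector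
  \<open>f = \<Sum>k<N. \<epsilon>\<^sub>k b\<^sub>k\<close> has norm \<open>N\<close> to the power \<open>1/p\<close>, and by disjointness
  \<open>\<K>(f) - l(f) = \<Sum>k<N. \<epsilon>\<^sub>k (w\<^sub>k - c b\<^sub>k)\<close> with \<open>c = ln N / p\<close>. Averaging over all signs isolates, on the
  support of each \<open>b\<^sub>n\<close>, the single term \<open>w\<^sub>n - c b\<^sub>n\<close> (the off-diagonal parts of the \<open>w\<^sub>k\<close> can only
  increase the average), so that after adding \<open>w\<^sub>n\<close> back and integrating one gets \<open>c \<le> 4 C\<close> for
  every \<open>N\<close>, which is absurd.
\<close>

section \<open>Power inequalities and averages over signs\<close>

lemma powr_add_le:
  fixes a b p :: real
  assumes "0 \<le> a" "0 \<le> b" "0 \<le> p"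
  shows "(a + b) powr p \<le> 2 powr p * (a powr p + b powr p)"
proof -
  have "(a + b) powr p \<le> (2 * max a b) powr p"
    using assms by (intro powr_mono2) auto
  also have "\<dots> = 2 powr p * max a b powr p"
    using assms by (simp add: powr_mult)
  also have "\<dots> \<le> 2 powr p * (a powr p + b powr p)"
    by (intro mult_left_mono) (auto simp: max_def)
  finally show ?thesis .
qed

text \<open>Half the difference of \<open>y + x\<close> and \<open>y - x\<close> is
  \<open>x\<close>: the triangle inequality, then midpoint convexity of
  \<open>t powr p\<close>.\<close>

lemma two_norm_powr_le:
  fixes x y :: "'a :: real_normed_vector"
  assumes "1 \<le> p"
  shows "2 * norm x powr p \<le> norm (y + x) powr p + norm (y - x) powr p"
proof -
  let ?a = "norm (y + x)" and ?b = "norm (y - x)"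
  have "2 * norm x = norm ((y + x) - (y - x))"
    by (simp add: algebra_simps flip: scaleR_2)
  also have "\<dots> \<le> ?a + ?b" by (rule norm_triangle_ineq4)
  finally have "norm x powr p \<le> ((?a + ?b) / 2) powr p"
    using assms by (intro powr_mono2) auto
  also have "\<dots> \<le> (?a powr p + ?b powr p) / 2"
  proof -
    \<comment> \<open>Convexity covers two positive numbers; if one vanishes, the claim reduces to
      \<open>half\<close>.\<close>
    have half: "(t / 2) powr p \<le> t powr p / 2" if "0 \<le> t" for t :: real
    proof -
      have "2 powr 1 \<le> (2::real) powr p" using assms by (intro powr_mono) auto
      then have "t powr p / 2 powr p \<le> t powr p / 2"
        by (intro divide_left_mono) auto
      then show ?thesis using that by (simp add: powr_divide)
    qed
    show ?thesis
    proof (cases "?a = 0 \<or> ?b = 0")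
      case True
      then show ?thesis using half[of ?a] half[of ?b] by auto
    next
      case False
      then show ?thesis
        using convex_onD[OF powr_convex[OF assms], of "1/2" ?a ?b] by (simp add: field_simps)
    qed
  qed
  finally show ?thesis by simp
qed

lemma sum_Pow_insert:
  fixes f :: "'a set \<Rightarrow> 'b :: comm_monoid_add"
  assumes "finite B" "n \<notin> B"
  shows "(\<Sum>S\<in>Pow (insert n B). f S) = (\<Sum>T\<in>Pow B. f T + f (insert n T))"
proof -
  have "inj_on (insert n) (Pow B)"
    using assms by (auto simp: inj_on_def)
  moreover have "Pow B \<inter> insert n ` Pow B = {}"
    using assms by auto
  ultimately show ?thesis
    using assms by (simp add: Pow_insert sum.union_disjoint sum.reindex sum.distrib)
qed

text \<open>A sign pattern is encoded by the set of its minus signs, so averaging over signs is a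
  sum over a power set.\<close>

definition sgn_of :: "'a set \<Rightarrow> 'a \<Rightarrow> complex" where
  "sgn_of S k = (if k \<in> S then - 1 else 1)"

text \<open>Pair each pattern with the one that differs only in the sign at \<open>n\<close>: the
  remaining sum \<open>R T\<close> is common to both, and \<open>two_norm_powr_le\<close> applies to
  each pair.\<close>

lemma norm_powr_le_sign_average:
  fixes z :: "'a \<Rightarrow> complex"
  assumes "finite A" "n \<in> A" "1 \<le> p"
  shows "2 ^ card A * norm (z n) powr p
    \<le> (\<Sum>S\<in>Pow A. norm (\<Sum>k\<in>A. sgn_of S k * z k) powr p)"
proof -
  define B where "B = A - {n}"
  have A: "A = insert n B" "n \<notin> B" "finite B" using assms by (auto simp: B_def)
  define R where "R T = (\<Sum>k\<in>B. sgn_of T k * z k)" for T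
  have R_insert: "R (insert n T) = R T" for T
    unfolding R_def using A by (intro sum.cong) (auto simp: sgn_of_def)
  have "(\<Sum>T\<in>Pow B. 2 * norm (z n) powr p)
      \<le> (\<Sum>T\<in>Pow B. norm (R T + z n) powr p + norm (R T - z n) powr p)"
    by (intro sum_mono two_norm_powr_le assms)
  also have "\<dots> = (\<Sum>T\<in>Pow B. norm (\<Sum>k\<in>A. sgn_of T k * z k) powr p
      + norm (\<Sum>k\<in>A. sgn_of (insert n T) k * z k) powr p)"
  proof (intro sum.cong refl)
    fix T assume "T \<in> Pow B"
    then have "n \<notin> T" using A by auto
    then have "(\<Sum>k\<in>A. sgn_of T k * z k) = R T + z n"
      "(\<Sum>k\<in>A. sgn_of (insert n T) k * z k) = R T - z n"
      using A R_insert[of T] by (simp_all add: R_def sgn_of_def)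
    then show "norm (R T + z n) powr p + norm (R T - z n) powr p
      = norm (\<Sum>k\<in>A. sgn_of T k * z k) powr p
        + norm (\<Sum>k\<in>A. sgn_of (insert n T) k * z k) powr p" by simp
  qed
  also have "\<dots> = (\<Sum>S\<in>Pow A. norm (\<Sum>k\<in>A. sgn_of S k * z k) powr p)"
    unfolding A(1) by (rule sum_Pow_insert[OF A(3,2), symmetric])
  finally show ?thesis using A by (simp add: card_Pow mult_ac)
qed

text \<open>At most one term is nonzero, so \<open>h\<close> only has to preserve zero. This serves
  both p-th powers of the modulus and the nonlinear function behind the Kalton-Peck map.\<close>

lemma disjoint_sum_apply:
  fixes z :: "'a \<Rightarrow> 'b :: comm_monoid_add" and h :: "'b \<Rightarrow> 'c :: comm_monoid_add"
  assumes "finite A" "\<And>i j. i \<in> A \<Longrightarrow> j \<in> A \<Longrightarrow> i \<noteq> j \<Longrightarrow> z i = 0 \<or> z j = 0" "h 0 = 0"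
  shows "h (\<Sum>k\<in>A. z k) = (\<Sum>k\<in>A. h (z k))"
proof (cases "\<exists>n\<in>A. z n \<noteq> 0")
  case True
  then obtain n where n: "n \<in> A" "z n \<noteq> 0" by auto
  have "z k = 0" if "k \<in> A - {n}" for k using assms(2)[of k n] that n by auto
  then show ?thesis
    using assms n by (simp add: sum.remove[of A n])
qed (use assms in simp)

section \<open>The L_p norm and disjoint sums\<close>

lemma Lp_norm_nonneg: "0 \<le> Lp_norm p f"
  by (simp add: Lp_norm_def)

lemma Lp_norm_powr:
  assumes "0 < p"
  shows "Lp_norm p f powr p = (LINT x|I01. norm (f x) powr p)"
  using assms by (simp add: Lp_norm_def powr_powr)

lemma Lp_norm_pos:
  assumes "f \<in> Lp p" "\<not> (AE x in I01. f x = 0)"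
  shows "0 < Lp_norm p f"
proof -
  have "(LINT x|I01. norm (f x) powr p) \<noteq> 0"
    using assms by (subst integral_nonneg_eq_0_iff_AE) (auto simp: Lp_def)
  then show ?thesis by (simp add: Lp_norm_def)
qed

lemma Lp_cmult:
  assumes "f \<in> Lp p"
  shows "(\<lambda>x. c * f x) \<in> Lp p"
  using assms by (auto simp: Lp_def L0_def norm_mult powr_mult)

lemma Lp_norm_cmult:
  assumes "0 < p"
  shows "Lp_norm p (\<lambda>x. c * f x) = norm c * Lp_norm p f"
  using assms by (simp add: Lp_norm_def norm_mult powr_mult powr_powr)

lemma nonzero_disjoint_seq_AE:
  assumes "nonzero_disjoint_seq p u"
  shows "AE x in I01. \<forall>m n. m \<noteq> n \<longrightarrow> u m x = 0 \<or> u n x = 0"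
  using assms by (auto simp: nonzero_disjoint_seq_def AE_all_countable)

lemma disjoint_sum_Lp:
  assumes "nonzero_disjoint_seq p u"
  shows "(\<lambda>x. \<Sum>k<n. c k * u k x) \<in> Lp p"
    and "(LINT x|I01. norm (\<Sum>k<n. c k * u k x) powr p)
      = (\<Sum>k<n. LINT x|I01. norm (c k * u k x) powr p)"
proof -
  have Lp: "(\<lambda>x. c k * u k x) \<in> Lp p" for k
    using assms by (intro Lp_cmult) (auto simp: nonzero_disjoint_seq_def)
  then have meas [measurable]: "(\<lambda>x. c k * u k x) \<in> borel_measurable I01"
    and int: "integrable I01 (\<lambda>x. norm (c k * u k x) powr p)" for k
    by (auto simp: Lp_def L0_def)
  have AE: "AE x in I01. norm (\<Sum>k<n. c k * u k x) powr p = (\<Sum>k<n. norm (c k * u k x) powr p)"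
    using nonzero_disjoint_seq_AE[OF assms]
    by eventually_elim (rule disjoint_sum_apply[where h = "\<lambda>z. norm z powr p"], auto)
  have "integrable I01 (\<lambda>x. norm (\<Sum>k<n. c k * u k x) powr p)"
    by (subst integrable_cong_AE[OF _ _ AE]) (auto intro!: int)
  then show "(\<lambda>x. \<Sum>k<n. c k * u k x) \<in> Lp p"
    by (auto simp: Lp_def L0_def)
  have "(LINT x|I01. norm (\<Sum>k<n. c k * u k x) powr p)
      = (LINT x|I01. (\<Sum>k<n. norm (c k * u k x) powr p))"
    by (intro integral_cong_AE AE) auto
  also have "\<dots> = (\<Sum>k<n. LINT x|I01. norm (c k * u k x) powr p)"
    by (intro Bochner_Integration.integral_sum int)
  finally show "(LINT x|I01. norm (\<Sum>k<n. c k * u k x) powr p)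
      = (\<Sum>k<n. LINT x|I01. norm (c k * u k x) powr p)" .
qed

lemma disjoint_sum_in_closed_span:
  assumes "nonzero_disjoint_seq p u"
  shows "(\<lambda>x. \<Sum>k<n. c k * u k x) \<in> closed_span p u"
proof -
  let ?f = "\<lambda>x. \<Sum>k<n. c k * u k x"
  have "?f \<in> lin_span u" by (auto simp: lin_span_def)
  moreover have "Lp_norm p (\<lambda>x. ?f x - ?f x) = 0" by (simp add: Lp_norm_def)
  ultimately show ?thesis
    unfolding closed_span_def using disjoint_sum_Lp(1)[OF assms] by (auto intro!: bexI[of _ ?f])
qed

lemma cmult_in_closed_span:
  assumes "nonzero_disjoint_seq p u"
  shows "(\<lambda>x. c * u n x) \<in> closed_span p u"
  \<comment> \<open>All coefficients vanish except at \<open>n\<close>; the bound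
    \<open>Suc n\<close> keeps that index in range.\<close>
  using disjoint_sum_in_closed_span[OF assms, where n = "Suc n" and c = "\<lambda>k. if k = n then c else 0"]
  by (simp add: if_distrib[of "\<lambda>t. t * _"] cong: if_cong)

section \<open>Linear maps on finite combinations\<close>

lemma linear_into_L0_add:
  assumes "linear_into_L0 W l" "f \<in> W" "g \<in> W"
  shows "AE x in I01. l (\<lambda>t. f t + g t) x = l f x + l g x"
  using assms by (simp add: linear_into_L0_def)

lemma linear_into_L0_sum:
  assumes u: "nonzero_disjoint_seq p u" and l: "linear_into_L0 (closed_span p u) l"
  shows "AE x in I01. l (\<lambda>t. \<Sum>k<n. c k * u k t) x = (\<Sum>k<n. c k * l (u k) x)"
proof (induction n)
  case 0
  \<comment> \<open>The empty sum is viewed as \<open>0 * u 0\<close>, so homogeneity gives its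
    image.\<close>
  have "u 0 \<in> closed_span p u" using cmult_in_closed_span[OF u, of 1 0] by simp
  with l have "AE x in I01. l (\<lambda>t. 0 * u 0 t) x = 0 * l (u 0) x"
    unfolding linear_into_L0_def by blast
  then show ?case by simp
next
  case (Suc n)
  have "u n \<in> closed_span p u" using cmult_in_closed_span[OF u, of 1 n] by simp
  with l have scale: "AE x in I01. l (\<lambda>t. c n * u n t) x = c n * l (u n) x"
    unfolding linear_into_L0_def by blast
  have "AE x in I01. l (\<lambda>t. (\<Sum>k<n. c k * u k t) + c n * u n t) x
      = l (\<lambda>t. \<Sum>k<n. c k * u k t) x + l (\<lambda>t. c n * u n t) x"
    by (rule linear_into_L0_add[OF l disjoint_sum_in_closed_span[OF u] cmult_in_closed_span[OF u]])
  with scale Suc show ?case by eventually_elim simp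
qed

section \<open>Signed sums under the Kalton-Peck map and the logarithmic bound\<close>

lemma kalton_peck_disjoint_sum:
  assumes "0 < p" "0 < N"
    and b: "\<And>k. k < N \<Longrightarrow> Lp_norm p (b k) = 1"
    and disj: "\<And>m n. m \<noteq> n \<Longrightarrow> b m x = 0 \<or> b n x = 0"
    and norm: "Lp_norm p (\<lambda>x. \<Sum>k<N. sgn_of S k * b k x) = real N powr (1 / p)"
  shows "kalton_peck p (\<lambda>x. \<Sum>k<N. sgn_of S k * b k x) x
    = (\<Sum>k<N. sgn_of S k * (kalton_peck p (b k) x - of_real (ln N / p) * b k x))"
proof -
  \<comment> \<open>Dividing by the norm \<open>N powr (1 / p)\<close> subtracts
    \<open>ln N / p\<close> from the logarithm. As \<open>h\<close> preserves zero, it distributes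
    over the disjoint terms; signs have modulus one and pull out of it.\<close>
  define h where "h z = (if z = 0 then 0 else z * of_real (ln (norm z) - ln N / p))" for z :: complex
  have "kalton_peck p (\<lambda>x. \<Sum>k<N. sgn_of S k * b k x) x = h (\<Sum>k<N. sgn_of S k * b k x)"
    using assms(1,2) unfolding kalton_peck_def norm h_def by (simp add: ln_div ln_powr)
  also have "\<dots> = (\<Sum>k<N. h (sgn_of S k * b k x))"
    by (rule disjoint_sum_apply) (use disj in \<open>auto simp: h_def\<close>)
  also have "\<dots> = (\<Sum>k<N. sgn_of S k * (kalton_peck p (b k) x - of_real (ln N / p) * b k x))"
    by (intro sum.cong refl)
      (simp add: kalton_peck_def b h_def sgn_of_def norm_mult right_diff_distrib mult.commute)
  finally show ?thesis .
qed

text \<open>At most one \<open>b n\<close> is nonzero; split it as \<open>w n - (w n - b n)\<close>.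
  The sign average controls the second part and the whole sum over \<open>w\<close> the first. It is
  applied pointwise, with \<open>b\<close> scaled by \<open>c\<close>.\<close>

lemma disjoint_powr_le_sign_average:
  fixes b w :: "nat \<Rightarrow> complex"
  assumes "1 \<le> p" "\<And>m n. m \<noteq> n \<Longrightarrow> b m = 0 \<or> b n = 0"
  shows "(\<Sum>k<N. norm (b k) powr p)
    \<le> 2 powr p * ((\<Sum>S\<in>Pow {..<N}. norm (\<Sum>k<N. sgn_of S k * (w k - b k)) powr p) / 2 ^ N
      + (\<Sum>k<N. norm (w k) powr p))" (is "_ \<le> 2 powr p * (?G / _ + ?V)")
proof (cases "\<exists>n<N. b n \<noteq> 0")
  case True
  then obtain n where n: "n < N" "b n \<noteq> 0" by auto
  have "b k = 0" if "k \<in> {..<N} - {n}" for k using assms(2)[of k n] that n by auto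
  then have "(\<Sum>k<N. norm (b k) powr p) = norm (b n) powr p"
    using n by (simp add: sum.remove[of "{..<N}" n])
  also have "\<dots> \<le> (norm (w n - b n) + norm (w n)) powr p"
    using assms(1) norm_triangle_ineq4[of "w n" "w n - b n"] by (intro powr_mono2) auto
  also have "\<dots> \<le> 2 powr p * (norm (w n - b n) powr p + norm (w n) powr p)"
    using assms(1) by (intro powr_add_le) auto
  also have "\<dots> \<le> 2 powr p * (?G / 2 ^ N + ?V)"
  proof (intro mult_left_mono add_mono)
    show "norm (w n - b n) powr p \<le> ?G / 2 ^ N"
      using norm_powr_le_sign_average[of "{..<N}" n p "\<lambda>k. w k - b k"] n assms(1)
      by (simp add: field_simps)
    show "norm (w n) powr p \<le> ?V"
      using n by (intro member_le_sum) auto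
  qed auto
  finally show ?thesis .
qed (simp add: sum_nonneg)

lemma kalton_peck_linear_approx_lower_bound:
  assumes p: "1 < p" and u: "nonzero_disjoint_seq p u"
    and l: "linear_into_L0 (closed_span p u) l"
    and Lp: "\<And>f. f \<in> closed_span p u \<Longrightarrow> (\<lambda>x. kalton_peck p f x - l f x) \<in> Lp p"
    and bound: "\<And>f. f \<in> closed_span p u \<Longrightarrow>
      Lp_norm p (\<lambda>x. kalton_peck p f x - l f x) \<le> C * Lp_norm p f"
    and "0 < N"
  shows "ln (real N) \<le> 4 * C * p"
proof -
  define r where "r k = Lp_norm p (u k)" for k
  define b where "b k x = of_real (1 / r k) * u k x" for k x
  define c where "c = ln (real N) / p"
  define w where "w k x = kalton_peck p (b k) x - l (b k) x" for k x
  define f where "f S x = (\<Sum>k<N. sgn_of S k * b k x)" for S x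
  \<comment> \<open>Stated through \<open>w\<close> and \<open>b\<close> to match the pointwise
    inequality; almost everywhere it is the p-th power of the error of \<open>l\<close> at
    \<open>f S\<close>.\<close>
  define G where "G S x = norm (\<Sum>k<N. sgn_of S k * (w k x - of_real c * b k x)) powr p" for S x
  have r: "0 < r k" for k
    using u unfolding r_def nonzero_disjoint_seq_def by (intro Lp_norm_pos) auto
  have b_span: "b k \<in> closed_span p u" for k
    unfolding b_def by (rule cmult_in_closed_span[OF u])
  have b_norm: "Lp_norm p (b k) = 1" for k
    unfolding b_def using p r[of k] by (subst Lp_norm_cmult) (auto simp: r_def norm_divide)
  have b_int: "(LINT x|I01. norm (b k x) powr p) = 1" for k
    using Lp_norm_powr[of p "b k"] p b_norm by simp
  have "w k \<in> Lp p" for k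
    unfolding w_def using Lp[OF b_span] .
  then have w_meas [measurable]: "w k \<in> borel_measurable I01"
    and w_integrable: "integrable I01 (\<lambda>x. norm (w k x) powr p)" for k
    by (auto simp: Lp_def L0_def)
  have "b k \<in> Lp p" for k
    using b_span by (auto simp: closed_span_def)
  then have b_meas [measurable]: "b k \<in> borel_measurable I01"
    and b_integrable: "integrable I01 (\<lambda>x. norm (b k x) powr p)" for k
    by (auto simp: Lp_def L0_def)
  have w_norm: "Lp_norm p (w k) \<le> C" for k
    using bound[OF b_span[of k]] by (simp add: w_def[abs_def] b_norm)
  \<comment> \<open>\<open>C\<close> is an arbitrary real; its sign is read off from a norm that it
    bounds.\<close>
  then have "0 \<le> C"
    using Lp_norm_nonneg order_trans by blast
  have w_int: "(LINT x|I01. norm (w k x) powr p) \<le> C powr p" for k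
    using p w_norm[of k] powr_mono2[of p "Lp_norm p (w k)" C]
    by (simp add: Lp_norm_powr Lp_norm_nonneg)
  have disj: "AE x in I01. \<forall>m n. m \<noteq> n \<longrightarrow> b m x = 0 \<or> b n x = 0"
    using nonzero_disjoint_seq_AE[OF u] by eventually_elim (auto simp: b_def)
  have f_eq: "f S = (\<lambda>x. \<Sum>k<N. sgn_of S k * of_real (1 / r k) * u k x)" for S
    by (simp add: f_def b_def mult.assoc fun_eq_iff)
  have f_span: "f S \<in> closed_span p u" for S
    unfolding f_eq by (rule disjoint_sum_in_closed_span[OF u])
  have f_norm: "Lp_norm p (f S) = real N powr (1 / p)" for S
  proof -
    have "(LINT x|I01. norm (f S x) powr p) = (\<Sum>k<N. LINT x|I01. norm (b k x) powr p)"
      unfolding f_eq disjoint_sum_Lp(2)[OF u]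
      by (intro sum.cong refl Bochner_Integration.integral_cong)
        (simp_all add: b_def sgn_of_def norm_mult)
    then show ?thesis by (simp add: Lp_norm_def b_int)
  qed
  have G_AE: "AE x in I01. G S x = norm (kalton_peck p (f S) x - l (f S) x) powr p" for S
  proof -
    \<comment> \<open>\<open>l\<close> is homogeneous only almost everywhere; one null set serves
      all \<open>k\<close>.\<close>
    have scale: "AE x in I01. \<forall>k. l (b k) x = of_real (1 / r k) * l (u k) x"
      unfolding AE_all_countable
    proof
      fix k
      have "u k \<in> closed_span p u" using cmult_in_closed_span[OF u, of 1 k] by simp
      with l show "AE x in I01. l (b k) x = of_real (1 / r k) * l (u k) x"
        unfolding linear_into_L0_def b_def by blast
    qed
    have "AE x in I01. l (f S) x = (\<Sum>k<N. sgn_of S k * of_real (1 / r k) * l (u k) x)"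
      unfolding f_eq by (rule linear_into_L0_sum[OF u l])
    with scale disj show ?thesis
    proof eventually_elim
      case (elim x)
      have "kalton_peck p (f S) x
          = (\<Sum>k<N. sgn_of S k * (kalton_peck p (b k) x - of_real c * b k x))"
        unfolding f_def c_def
        by (rule kalton_peck_disjoint_sum)
          (use p \<open>0 < N\<close> b_norm elim f_norm[of S] in \<open>auto simp: f_def[abs_def]\<close>)
      moreover have "l (f S) x = (\<Sum>k<N. sgn_of S k * l (b k) x)"
        using elim by (simp add: mult.assoc)
      ultimately show ?case
        by (simp add: G_def w_def algebra_simps flip: sum_subtractf)
    qed
  qed
  have G_meas [measurable]: "G S \<in> borel_measurable I01" for S
    unfolding G_def[abs_def] by measurable
  have D_meas: "(\<lambda>x. norm (kalton_peck p (f S) x - l (f S) x) powr p) \<in> borel_measurable I01"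
    and D_integrable: "integrable I01 (\<lambda>x. norm (kalton_peck p (f S) x - l (f S) x) powr p)" for S
    using Lp[OF f_span[of S]] by (auto simp: Lp_def)
  have G_integrable: "integrable I01 (G S)" for S
    using integrable_cong_AE[OF G_meas D_meas G_AE] D_integrable by blast
  have G_int: "(LINT x|I01. G S x) \<le> C powr p * N" for S
  proof -
    let ?D = "\<lambda>x. kalton_peck p (f S) x - l (f S) x"
    have "(LINT x|I01. G S x) = Lp_norm p ?D powr p"
      using p integral_cong_AE[OF G_meas D_meas G_AE] by (simp add: Lp_norm_powr)
    also have "\<dots> \<le> (C * real N powr (1 / p)) powr p"
      using bound[OF f_span[of S]] p f_norm[of S] by (intro powr_mono2 Lp_norm_nonneg) auto
    also have "\<dots> = C powr p * N"
      using p \<open>0 \<le> C\<close> by (simp add: powr_mult powr_powr)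
    finally show ?thesis .
  qed
  have "0 \<le> c" using p \<open>0 < N\<close> by (simp add: c_def)
  let ?R = "\<lambda>x. 2 powr p * ((\<Sum>S\<in>Pow {..<N}. G S x) / 2 ^ N + (\<Sum>k<N. norm (w k x) powr p))"
  \<comment> \<open>Each of the \<open>N\<close> normalised vectors contributes
    \<open>c powr p\<close>.\<close>
  have "N * c powr p = (LINT x|I01. (\<Sum>k<N. norm (of_real c * b k x) powr p))"
    using \<open>0 \<le> c\<close> b_integrable by (simp add: norm_mult powr_mult b_int)
  also have "\<dots> \<le> (LINT x|I01. ?R x)"
  proof (rule integral_mono_AE)
    show "AE x in I01. (\<Sum>k<N. norm (of_real c * b k x) powr p) \<le> ?R x"
      using disj
    proof eventually_elim
      case (elim x)
      then show ?case
        unfolding G_def using p by (intro disjoint_powr_le_sign_average) auto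
    qed
  qed (use b_integrable w_integrable G_integrable in \<open>simp_all add: norm_mult powr_mult\<close>)
  also have "\<dots> = 2 powr p * ((\<Sum>S\<in>Pow {..<N}. LINT x|I01. G S x) / 2 ^ N
      + (\<Sum>k<N. LINT x|I01. norm (w k x) powr p))"
    using w_integrable G_integrable by simp
  \<comment> \<open>There are \<open>2 ^ N\<close> patterns, so the average is at most
    \<open>C powr p * N\<close>; the \<open>w k\<close> add the same amount, whence the extra factor
    2.\<close>
  also have "\<dots> \<le> 2 powr p * ((\<Sum>S\<in>Pow {..<N}. C powr p * N) / 2 ^ N + (\<Sum>k<N. C powr p))"
    by (intro mult_left_mono add_mono divide_right_mono sum_mono G_int w_int) auto
  also have "\<dots> = N * (2 powr p * 2 * C powr p)"
    by (simp add: card_Pow algebra_simps)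
  finally have "c powr p \<le> 2 powr p * 2 powr 1 * C powr p"
    using \<open>0 < N\<close> by simp
  \<comment> \<open>Enlarging the factor 2 makes the right side a p-th power, so roots can be taken;
    this is where 4 comes from.\<close>
  also have "\<dots> \<le> 2 powr p * 2 powr p * C powr p"
    using p by (intro mult_right_mono mult_left_mono powr_mono) auto
  also have "\<dots> = (4 * C) powr p"
    using \<open>0 \<le> C\<close> by (simp add: powr_mult flip: powr_mult[of 2 2])
  finally have "c \<le> 4 * C"
    using p \<open>0 \<le> c\<close> \<open>0 \<le> C\<close> powr_less_mono2[of p "4 * C" c] by force
  then show ?thesis using p by (simp add: c_def field_simps)
qed

theorem proposition5p3:
  fixes p :: real
  assumes "1 < p"
  shows "disjointly_singular p (kalton_peck p)"
  unfolding disjointly_singular_def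
proof clarify
  fix u l C
  assume "nonzero_disjoint_seq p u" "linear_into_L0 (closed_span p u) l"
    "\<forall>f\<in>closed_span p u. (\<lambda>x. kalton_peck p f x - l f x) \<in> Lp p \<and>
      Lp_norm p (\<lambda>x. kalton_peck p f x - l f x) \<le> C * Lp_norm p f"
  then have ln_le: "ln (real N) \<le> 4 * C * p" if "0 < N" for N
    using kalton_peck_linear_approx_lower_bound[OF assms] that by blast
  \<comment> \<open>The bound on \<open>ln (real N)\<close> is independent of \<open>N\<close>, so
    any \<open>N\<close> beyond its exponential contradicts it.\<close>
  obtain N where N: "exp (4 * C * p) < real N"
    using reals_Archimedean2 by blast
  moreover from this have "0 < real N"
    using exp_gt_zero less_trans by blast
  ultimately have "4 * C * p < ln (real N)"
    by (metis exp_less_cancel_iff exp_ln)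
  with ln_le[of N] \<open>0 < real N\<close> show False by simp
qed

end
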